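(* Fix integers $m>1$ and $n\ge 1$. For $i=1,\dots,n$ let $h_i:\mathbb{R}\to[0,\infty)$ be measurable, and let $$F_i=\begin{pmatrix} A_i & B_i\\ -B_i & A_i\end{pmatrix}\in\mathbb{R}^{2m\times 2m},$$ where each $A_i\in\mathbb{R}^{m\times m}$ is symmetric and each $B_i\in\mathbb{R}^{m\times m}$ is antisymmetric ($B_i^\top=-B_i$). Suppose that $(x,y)\mapsto \prod_{i=1}^n h_i\big((x^\top,y^\top)F_i(x,y)^\top\big)$ is integrable over $\mathbb{R}^{2m}$ with positive integral, and let $X=(X_1,\dots,X_m)$, $Y=(Y_1,\dots,Y_m)$ be random vectors in $\mathbb{R}^m$ with joint density $$f_{X,Y}(x,y)=K\prod_{i=1}^n h_i\big((x^\top,y^\top)F_i(x,y)^\top\big),$$ $K$ being the normalizing constant. Let $w=(w_1,\dots,w_m)$ be deterministic with $w_j\ge 0$ for all $j$ and $\sum_{j=1}^m w_j=1$. Then $Z=\sum_{j=1}^m w_j\,X_j/Y_j$ has the standard Cauchy distribution. Moreover, for each $1\le j\le m$, $X_j/Y_j$ has the standard Cauchy distribution.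
   Context: The standard Cauchy distribution $\mathrm{Cauchy}(0,1)$ is the distribution on $\mathbb{R}$ with density $\frac{1}{\pi(1+z^2)}$. (Note $Y_j\neq 0$ almost surely since $(X,Y)$ has a density.) *)

theory Defs
  imports "HOL-Probability.Probability"
begin

definition cauchy_density :: "real \<Rightarrow> real" where
  "cauchy_density z = 1 / (pi * (1 + z^2))"

text \<open>The quadratic form (x^T, y^T) F (x, y)^T for the block matrix
  F = [[A, B], [-B, A]], written out blockwise.\<close>
definition block_qf :: "real^'m^'m \<Rightarrow> real^'m^'m \<Rightarrow> real^'m \<Rightarrow> real^'m \<Rightarrow> real" where
  "block_qf A B x y = x \<bullet> (A *v x + B *v y) + y \<bullet> ((- B) *v x + A *v y)"

end

theory Submission
  imports Defs "HOL-Complex_Analysis.Complex_Analysis"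
begin

text \<open>
  With z = x + i y, each quadratic form is Hermitian in z, hence the joint density is invariant
  under the rotations z \<mapsto> e^{-i \<theta>} z, and so the law of (X, Y) does not change when it is
  averaged over \<theta> = \<pi> s with s uniform on (0, 1). For fixed z, put q = e^{2 \<pi> i s} and
  v_j = cnj z_j / z_j; the rotated ratio is x_j / y_j = i (1 + v_j q) / (1 - v_j q). For t \<ge> 0,
  the function exp (- t (\<Sum>j. w_j (1 + v_j q) / (1 - v_j q))) is holomorphic and bounded by 1 on
  the unit disc, so its mean over the unit circle is its value e^{-t} at q = 0. This is the
  characteristic function of Z. The case of a single z_j = 1 computes the characteristic function
  of the Cauchy distribution as well, because then the ratio is tan (\<pi> s - \<pi> / 2).
\<close>

section \<open>The uniform parameter on (0, 1) and means over circles\<close>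

definition unit_uniform :: "real measure" where
  "unit_uniform = density lborel (\<lambda>s. ennreal (indicator {0<..<1} s))"

lemma sets_unit_uniform [simp, measurable_cong]: "sets unit_uniform = sets borel"
  and space_unit_uniform [simp]: "space unit_uniform = UNIV"
  by (simp_all add: unit_uniform_def)

lemma prob_space_unit_uniform: "prob_space unit_uniform"
  by (rule prob_spaceI) (simp add: unit_uniform_def emeasure_density ennreal_indicator)

text \<open>The strict bounds put the angle pi * s in (0, pi), the range of angles for which
  rotation invariance of the law is established.\<close>

lemma AE_unit_uniform_in: "AE s in unit_uniform. s \<in> {0<..<1}"
  unfolding unit_uniform_def by (subst AE_density) (auto split: split_indicator)

lemma integral_unit_uniform:
  fixes f :: "real \<Rightarrow> complex"
  assumes "f \<in> borel_measurable borel"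
  shows "integral\<^sup>L unit_uniform f = (LINT s:{0<..<1}|lborel. f s)"
  unfolding unit_uniform_def set_lebesgue_integral_def
  using assms by (subst integral_density) auto

text \<open>This is Cauchy's formula at the centre: on u = r e^{2 pi i s} one has du / u = 2 pi i
  ds, so the contour integral is 2 pi i times the mean. The radius stays below 1 because
  \<open>f\<close> is only assumed holomorphic on the open disc.\<close>

lemma circle_mean_holomorphic:
  assumes hol: "f holomorphic_on ball 0 1" and r: "0 < r" "r < 1"
  shows "(LINT s|unit_uniform. f (of_real r * cis (2 * pi * s))) = f 0"
proof -
  let ?g = "\<lambda>s. f (of_real r * cis (2 * pi * s))"
  have "f holomorphic_on cball 0 r"
    by (rule holomorphic_on_subset[OF hol]) (use r in auto)
  from Cauchy_integral_circlepath_simple[OF this, of 0] r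
  have "((\<lambda>u. f u / (u - 0)) has_contour_integral (2 * of_real pi * \<i> * f 0)) (circlepath 0 r)"
    by simp
  then have "((\<lambda>s. (2 * of_real pi * \<i>) * ?g s) has_integral ((2 * of_real pi * \<i>) * f 0)) {0..1}"
    unfolding has_contour_integral_def
  proof (rule has_integral_eq[rotated])
    fix s :: real assume s: "s \<in> {0..1}"
    have "exp (2 * of_real pi * \<i> * s) = cis (2 * pi * s)"
      by (simp add: cis_conv_exp mult_ac)
    then have "vector_derivative (circlepath 0 r) (at s within {0..1}) =
        (2 * of_real pi * \<i>) * (of_real r * cis (2 * pi * s))"
      "circlepath 0 r s = of_real r * cis (2 * pi * s)"
      using s by (simp_all add: vector_derivative_circlepath01) (simp add: circlepath)
    then show "f (circlepath 0 r s) / (circlepath 0 r s - 0) *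
        vector_derivative (circlepath 0 r) (at s within {0..1}) = 2 * of_real pi * \<i> * ?g s"
      using r by simp
  qed
  then have hi: "(?g has_integral f 0) {0..1}"
    using has_integral_mult_right_iff[of "2 * of_real pi * \<i>" ?g] by simp
  have cont: "continuous_on UNIV ?g"
    using r by (intro continuous_on_compose2[OF holomorphic_on_imp_continuous_on[OF hol]]
        continuous_intros) (auto simp: norm_mult)
  have int: "set_integrable lborel {0..1} ?g"
    by (rule borel_integrable_atLeastAtMost') (rule continuous_on_subset[OF cont], simp)
  have "(LINT s|unit_uniform. ?g s) = (LINT s:{0<..<1}|lborel. ?g s)"
    by (rule integral_unit_uniform) (rule borel_measurable_continuous_onI[OF cont])
  also have "\<dots> = integral {0<..<1} ?g"
    by (rule set_borel_integral_eq_integral(2), rule set_integrable_subset[OF int]) auto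
  also have "\<dots> = integral {0..1} ?g"
    using integral_open_interval[of 0 1 ?g] by simp
  finally show ?thesis
    using hi by (simp add: integral_unique)
qed

text \<open>On (0, 1) the map s to e^{2 pi i s} is injective, so at most one parameter is excluded.
  This discards the poles that the Cayley quotients have on the unit circle.\<close>

lemma AE_unit_uniform_cis_neq: "AE s in unit_uniform. cis (2 * pi * s) \<noteq> c"
proof -
  let ?N = "{s \<in> {0<..<1}. cis (2 * pi * s) = c}"
  have eq: "s = s'" if "s \<in> ?N" "s' \<in> ?N" for s s'
  proof -
    have "exp (\<i> * of_real (2 * pi * s)) = exp (\<i> * of_real (2 * pi * s'))"
      using that by (simp add: cis_conv_exp)
    then obtain n :: int where
      "\<i> * of_real (2 * pi * s) = \<i> * of_real (2 * pi * s') + (of_int (2 * n) * pi) * \<i>"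
      unfolding exp_eq by blast
    then have "2 * pi * s = 2 * pi * s' + of_int (2 * n) * pi"
      by (simp add: complex_eq_iff)
    then have "pi * (2 * s) = pi * (2 * (s' + of_int n))"
      by (simp add: algebra_simps)
    then have *: "s = s' + of_int n"
      by simp
    \<comment> \<open>Two points of the open interval (0, 1) are less than 1 apart, which forces the
      integer period to vanish.\<close>
    have "\<bar>of_int n :: real\<bar> < 1"
      using that * by auto
    then have "n = 0"
      by linarith
    with * show ?thesis by simp
  qed
  have "countable ?N"
  proof (cases "?N = {}")
    case False
    then obtain a where "a \<in> ?N" by blast
    with eq have "?N \<subseteq> {a}" by blast
    then show ?thesis
      by (rule countable_subset) simp
  qed (metis countable_empty)
  then have "?N \<in> null_sets lborel"
    by (rule countable_imp_null_set_lborel)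
  then have "AE s in lborel. s \<notin> ?N"
    by (rule AE_not_in)
  then show ?thesis
    unfolding unit_uniform_def
    by (subst AE_density) (auto split: split_indicator elim!: eventually_mono)
qed

section \<open>Circle means of exponentials of Cayley quotients\<close>

lemma Re_Cayley_nonneg:
  assumes "norm (a::complex) \<le> 1"
  shows "0 \<le> Re ((1 + a) / (1 - a))"
proof -
  have "(Re a)\<^sup>2 + (Im a)\<^sup>2 \<le> 1"
    using assms by (simp add: cmod_def real_sqrt_le_1_iff)
  \<comment> \<open>The quotient is (1 - |a|^2) / |1 - a|^2. At a = 1 division by zero makes it 0,
    in agreement with the Cayley quotient there.\<close>
  then have "0 \<le> (1 - ((Re a)\<^sup>2 + (Im a)\<^sup>2)) / ((1 - Re a)\<^sup>2 + (Im a)\<^sup>2)"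
    by simp
  also have "\<dots> = Re ((1 + a) / (1 - a))"
    by (simp add: Re_divide power2_eq_square algebra_simps)
  finally show ?thesis .
qed

text \<open>The integrand may have singularities on the unit circle, so the mean value property is
  applied on smaller circles and the radius then tends to 1 by dominated convergence. At the centre
  the exponent is -t times the sum of the weights, that is -t.\<close>

lemma mean_exp_Cayley:
  fixes v :: "'j \<Rightarrow> complex" and w :: "'j \<Rightarrow> real"
  assumes J: "finite J" and v: "\<And>j. j \<in> J \<Longrightarrow> norm (v j) = 1"
    and w: "\<And>j. j \<in> J \<Longrightarrow> 0 \<le> w j" "(\<Sum>j\<in>J. w j) = 1" and t: "0 \<le> t"
  shows "(LINT s|unit_uniform. exp (- of_real t * (\<Sum>j\<in>J. of_real (w j) *
      ((1 + v j * cis (2 * pi * s)) / (1 - v j * cis (2 * pi * s)))))) = of_real (exp (- t))"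
proof -
  interpret prob_space unit_uniform by (rule prob_space_unit_uniform)
  define P where "P q = (\<Sum>j\<in>J. of_real (w j) * ((1 + v j * q) / (1 - v j * q)))" for q
  define G where "G q = exp (- of_real t * P q)" for q
  \<comment> \<open>The shift by 2 makes the first radius 1/2, so every radius is positive and below
    1.\<close>
  define r :: "nat \<Rightarrow> real" where "r n = 1 - 1 / (real n + 2)" for n
  have r: "0 < r n" "r n < 1" for n
    by (auto simp: r_def field_simps)
  have r_lim: "r \<longlonglongrightarrow> 1"
  proof -
    have "(\<lambda>n. 1 / (real n + 2)) \<longlonglongrightarrow> 0"
      by real_asymp
    from tendsto_diff[OF tendsto_const this, of 1] show ?thesis
      unfolding r_def by simp
  qed
  have P0: "P 0 = 1"
    unfolding P_def using w(2) by (simp flip: of_real_sum)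
  \<comment> \<open>The norm is exp (- t * Re (P q)), and both t and Re (P q) are nonnegative. This
    gives the constant dominating function.\<close>
  have G_le: "norm (G q) \<le> 1" if "norm q \<le> 1" for q
  proof -
    have "0 \<le> (\<Sum>j\<in>J. w j * Re ((1 + v j * q) / (1 - v j * q)))"
      using w v that
      by (intro sum_nonneg mult_nonneg_nonneg Re_Cayley_nonneg) (auto simp: norm_mult)
    also have "\<dots> = Re (P q)"
      unfolding P_def Re_sum by (intro sum.cong refl) (simp del: times_divide_eq_right)
    finally have "0 \<le> Re (P q)" .
    with t show ?thesis
      by (simp add: G_def)
  qed
  have ne: "1 - v j * q \<noteq> 0" if "norm q < 1" "j \<in> J" for j q
  proof
    assume "1 - v j * q = 0"
    then have "norm (v j * q) = 1" by simp
    with that v show False by (simp add: norm_mult)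
  qed
  have hol: "G holomorphic_on ball 0 1"
    unfolding G_def P_def by (intro holomorphic_intros) (use ne in auto)
  have meas [measurable]: "(\<lambda>s. G (of_real \<rho> * cis (2 * pi * s))) \<in> borel_measurable borel" for \<rho>
    unfolding G_def P_def cis_conv_exp by measurable
  have "(\<lambda>n. LINT s|unit_uniform. G (of_real (r n) * cis (2 * pi * s)))
      \<longlonglongrightarrow> (LINT s|unit_uniform. G (of_real 1 * cis (2 * pi * s)))"
  proof (rule integral_dominated_convergence[where w = "\<lambda>_. 1"])
    \<comment> \<open>The j-th denominator vanishes on the unit circle only at
      \<open>inverse (v j)\<close>. Away from these finitely many points, convergence along the
      radius is continuity of \<open>P\<close>.\<close>
    have "AE s in unit_uniform. \<forall>j\<in>J. cis (2 * pi * s) \<noteq> inverse (v j)"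
      using J AE_unit_uniform_cis_neq by (simp add: AE_ball_countable countable_finite)
    then show "AE s in unit_uniform. (\<lambda>n. G (of_real (r n) * cis (2 * pi * s)))
        \<longlonglongrightarrow> G (of_real 1 * cis (2 * pi * s))"
    proof eventually_elim
      case (elim s)
      have "1 - v j * (of_real 1 * cis (2 * pi * s)) \<noteq> 0" if "j \<in> J" for j
      proof
        assume "1 - v j * (of_real 1 * cis (2 * pi * s)) = 0"
        then have "v j * cis (2 * pi * s) = 1" by simp
        then have "cis (2 * pi * s) = inverse (v j)"
          by (metis inverse_unique)
        with elim that show False by blast
      qed
      then show ?case
        unfolding G_def P_def by (intro tendsto_intros r_lim)
    qed
    show "AE s in unit_uniform. norm (G (of_real (r n) * cis (2 * pi * s))) \<le> 1" for n
      using r[of n] by (intro AE_I2 G_le) (simp add: norm_mult)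
  qed (use meas[of 1] meas in simp_all)
  \<comment> \<open>The means form a constant sequence, so their limit, the mean over the unit
    circle, is \<open>G 0\<close>.\<close>
  moreover have "(LINT s|unit_uniform. G (of_real (r n) * cis (2 * pi * s))) = G 0" for n
    by (rule circle_mean_holomorphic[OF hol r])
  ultimately have "(LINT s|unit_uniform. G (of_real 1 * cis (2 * pi * s))) = G 0"
    by (simp add: LIMSEQ_const_iff)
  then show ?thesis
    using P0 by (simp add: G_def P_def flip: exp_of_real)
qed

text \<open>Since x / y = i (z + cnj z) / (z - cnj z), dividing numerator and denominator by z gives
  the Cayley quotient of the unimodular number cnj z / z. For real z both sides are 0 by division by
  zero.\<close>

lemma Re_over_Im_eq_Cayley:
  assumes "z \<noteq> 0"
  shows "of_real (Re z / Im z) = \<i> * ((1 + cnj z / z) / (1 - cnj z / z))"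
proof -
  have "(1 + cnj z / z) / (1 - cnj z / z) = (z + cnj z) / (z - cnj z)"
  proof -
    have "1 + cnj z / z = (z + cnj z) / z" "1 - cnj z / z = (z - cnj z) / z"
      using assms by (simp_all add: add_divide_distrib diff_divide_distrib)
    then show ?thesis
      using assms by simp
  qed
  also have "\<dots> = of_real (Re z) / (\<i> * of_real (Im z))"
    by (simp add: complex_add_cnj complex_diff_cnj mult.commute)
  finally show ?thesis
    by simp
qed

text \<open>Multiplying z by e^{-i pi s} multiplies cnj z / z by e^{2 pi i s}. Half a turn of z is
  therefore a full turn of the disc variable, the same for all j, which turns the left side into the
  circle mean of \<open>mean_exp_Cayley\<close>.\<close>

lemma mean_iexp_rotated_ratios:
  fixes z :: "'j \<Rightarrow> complex" and w :: "'j \<Rightarrow> real"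
  assumes J: "finite J" and z: "\<And>j. j \<in> J \<Longrightarrow> z j \<noteq> 0"
    and w: "\<And>j. j \<in> J \<Longrightarrow> 0 \<le> w j" "(\<Sum>j\<in>J. w j) = 1" and t: "0 \<le> t"
  shows "(LINT s|unit_uniform. iexp (t * (\<Sum>j\<in>J. w j *
      (Re (cis (- (pi * s)) * z j) / Im (cis (- (pi * s)) * z j))))) = of_real (exp (- t))"
proof -
  let ?v = "\<lambda>j. cnj (z j) / z j"
  have *: "iexp (t * (\<Sum>j\<in>J. w j * (Re (cis (- (pi * s)) * z j) / Im (cis (- (pi * s)) * z j)))) =
      exp (- of_real t * (\<Sum>j\<in>J. of_real (w j) *
      ((1 + ?v j * cis (2 * pi * s)) / (1 - ?v j * cis (2 * pi * s)))))" for s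
  proof -
    have "of_real (w j * (Re (cis (- (pi * s)) * z j) / Im (cis (- (pi * s)) * z j))) =
      \<i> * (of_real (w j) * ((1 + ?v j * cis (2 * pi * s)) / (1 - ?v j * cis (2 * pi * s))))"
      if "j \<in> J" for j
    proof -
      have "cnj (cis (- (pi * s)) * z j) / (cis (- (pi * s)) * z j)
          = (cis (pi * s) / cis (- (pi * s))) * ?v j"
        by (simp add: cis_cnj)
      also have "cis (pi * s) / cis (- (pi * s)) = cis (2 * pi * s)"
        by (simp add: cis_divide mult.assoc)
      finally have "cnj (cis (- (pi * s)) * z j) / (cis (- (pi * s)) * z j) = ?v j * cis (2 * pi * s)"
        by (simp add: mult.commute)
      moreover have "cis (- (pi * s)) * z j \<noteq> 0"
        using z[OF that] by simp
      ultimately have "of_real (Re (cis (- (pi * s)) * z j) / Im (cis (- (pi * s)) * z j)) =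
        \<i> * ((1 + ?v j * cis (2 * pi * s)) / (1 - ?v j * cis (2 * pi * s)))"
        using Re_over_Im_eq_Cayley[of "cis (- (pi * s)) * z j"] by simp
      then show ?thesis
        by (simp only: of_real_mult mult_ac)
    qed
    then have "of_real (\<Sum>j\<in>J. w j * (Re (cis (- (pi * s)) * z j) / Im (cis (- (pi * s)) * z j))) =
      \<i> * (\<Sum>j\<in>J. of_real (w j) * ((1 + ?v j * cis (2 * pi * s)) / (1 - ?v j * cis (2 * pi * s))))"
      unfolding of_real_sum sum_distrib_left by (intro sum.cong) auto
    \<comment> \<open>One factor i comes from the characteristic function and one from the Cayley
      form of the ratio; their product -1 makes the exponential bounded for t \<ge> 0.\<close>
    moreover have "\<i> * (of_real t * (\<i> * c)) = - of_real t * c" for c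
      proof -
      have "\<i> * (of_real t * (\<i> * c)) = (\<i> * \<i>) * (of_real t * c)"
        by (simp only: mult_ac)
      then show ?thesis by simp
    qed
    ultimately show ?thesis
      unfolding of_real_mult by (simp only:)
  qed
  show ?thesis
    unfolding * by (rule mean_exp_Cayley[OF J _ w t]) (use z in \<open>auto simp: norm_divide\<close>)
qed

section \<open>The Cauchy distribution and its characteristic function\<close>

lemma borel_measurable_cauchy_density [measurable]: "cauchy_density \<in> borel_measurable borel"
  unfolding cauchy_density_def by measurable

lemma nn_integral_cauchy_density_atLeast:
  "(\<integral>\<^sup>+z. ennreal (cauchy_density z) * indicator {a..} z \<partial>lborel) = ennreal (1 / 2 - arctan a / pi)"
proof -
  have "(\<integral>\<^sup>+z. ennreal (cauchy_density z) * indicator {a..} z \<partial>lborel) = (pi / 2) / pi - arctan a / pi"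
  proof (rule nn_integral_FTC_atLeast[where F = "\<lambda>z. arctan z / pi"])
    show "cauchy_density \<in> borel_measurable borel"
      by measurable
    show "((\<lambda>z. arctan z / pi) has_real_derivative cauchy_density z) (at z)" for z
      unfolding cauchy_density_def
      by (auto intro!: derivative_eq_intros simp: field_simps add_nonneg_eq_0_iff)
    show "0 \<le> cauchy_density z" for z
      by (simp add: cauchy_density_def)
    show "((\<lambda>z. arctan z / pi) \<longlongrightarrow> (pi / 2) / pi) at_top"
      by (intro tendsto_intros tendsto_arctan_at_top) simp
  qed
  then show ?thesis by simp
qed

text \<open>The density is even, so the reflection z to -z reduces this to the upper tail.\<close>

lemma nn_integral_cauchy_density_atMost:
  "(\<integral>\<^sup>+z. ennreal (cauchy_density z) * indicator {..a} z \<partial>lborel) = ennreal (1 / 2 + arctan a / pi)"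
proof -
  have "(\<integral>\<^sup>+z. ennreal (cauchy_density z) * indicator {..a} z \<partial>lborel) =
      (\<integral>\<^sup>+z. ennreal (cauchy_density z) * indicator {..a} z \<partial>distr lborel borel uminus)"
    by (simp add: lborel_distr_uminus)
  also have "\<dots> = (\<integral>\<^sup>+z. ennreal (cauchy_density (- z)) * indicator {..a} (- z) \<partial>lborel)"
    by (rule nn_integral_distr) auto
  also have "\<dots> = (\<integral>\<^sup>+z. ennreal (cauchy_density z) * indicator {- a..} z \<partial>lborel)"
    by (intro nn_integral_cong) (auto simp: cauchy_density_def split: split_indicator)
  also have "\<dots> = ennreal (1 / 2 + arctan a / pi)"
    unfolding nn_integral_cauchy_density_atLeast by (simp add: arctan_minus)
  finally show ?thesis .
qed

lemma real_distribution_cauchy: "real_distribution (density lborel (\<lambda>z. ennreal (cauchy_density z)))"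
proof -
  \<comment> \<open>The two closed half-lines overlap at 0, which is a null set.\<close>
  have "AE z in lborel. z \<noteq> (0::real)"
    by (rule AE_lborel_singleton)
  then have "(\<integral>\<^sup>+z. ennreal (cauchy_density z) \<partial>lborel) =
      (\<integral>\<^sup>+z. ennreal (cauchy_density z) * indicator {..0} z +
        ennreal (cauchy_density z) * indicator {0..} z \<partial>lborel)"
    by (intro nn_integral_cong_AE) (auto elim!: eventually_mono split: split_indicator)
  also have "\<dots> = ennreal (1 / 2) + ennreal (1 / 2)"
    by (subst nn_integral_add)
      (simp_all add: nn_integral_cauchy_density_atLeast nn_integral_cauchy_density_atMost)
  also have "\<dots> = 1"
    by (simp only: ennreal_plus[symmetric]) simp
  finally have "prob_space (density lborel (\<lambda>z. ennreal (cauchy_density z)))"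
    by (intro prob_spaceI) (simp add: emeasure_density)
  then show ?thesis
    by (simp add: real_distribution_def real_distribution_axioms_def)
qed

text \<open>Both distribution functions are computed, using that arctan inverts tan on (-pi/2,
  pi/2). This realises the Cauchy law as a rotated ratio, so that its characteristic function is
  again a circle mean.\<close>

lemma distr_unit_uniform_tan:
  "distr unit_uniform borel (\<lambda>s. tan (pi * s - pi / 2)) =
    density lborel (\<lambda>z. ennreal (cauchy_density z))" (is "?T = ?C")
proof (rule cdf_unique)
  interpret prob_space unit_uniform by (rule prob_space_unit_uniform)
  have [measurable]: "(\<lambda>s. tan (pi * s - pi / 2)) \<in> borel_measurable borel"
    unfolding tan_def by measurable
  show "real_distribution ?T"
    by (rule real_distribution_distr) simp
  show "real_distribution ?C"
    by (rule real_distribution_cauchy)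
  show "cdf ?T = cdf ?C"
  proof
    fix x
    \<comment> \<open>The parameter at which tan (pi * s - pi / 2) reaches x, and also the Cauchy
      distribution function at x.\<close>
    define b where "b = 1 / 2 + arctan x / pi"
    have "- (pi / 2) < arctan x" "arctan x < pi / 2"
      using arctan_bounded by auto
    then have b: "0 < b" "b < 1"
      by (auto simp: b_def field_simps)
    have tan_le: "tan (pi * s - pi / 2) \<le> x \<longleftrightarrow> s \<le> b" if "0 < s" "s < 1" for s
    proof -
      have "pi * s < pi * 1"
        using that by (intro mult_strict_left_mono) auto
      then have s: "- (pi / 2) < pi * s - pi / 2" "pi * s - pi / 2 < pi / 2"
        using that by auto
      have "tan (pi * s - pi / 2) \<le> x \<longleftrightarrow> arctan (tan (pi * s - pi / 2)) \<le> arctan x"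
        by (simp only: arctan_le_iff)
      also have "arctan (tan (pi * s - pi / 2)) = pi * s - pi / 2"
        by (rule arctan_tan) (use s in auto)
      also have "pi * s - pi / 2 \<le> arctan x \<longleftrightarrow> s \<le> b"
        by (simp add: b_def field_simps)
      finally show ?thesis .
    qed
    have "emeasure ?T {..x} = emeasure unit_uniform {s. tan (pi * s - pi / 2) \<le> x}"
      by (subst emeasure_distr) (auto simp: vimage_def)
    also have "\<dots> = (\<integral>\<^sup>+s. indicator {0<..b} s \<partial>lborel)"
      unfolding unit_uniform_def
    proof (subst emeasure_density)
      show "(\<integral>\<^sup>+s. ennreal (indicator {0<..<1} s) * indicator {s. tan (pi * s - pi / 2) \<le> x} s \<partial>lborel) =
          (\<integral>\<^sup>+s. indicator {0<..b} s \<partial>lborel)"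
        using tan_le b by (intro nn_integral_cong) (auto split: split_indicator)
    qed simp_all
    also have "\<dots> = ennreal b"
      using b by simp
    also have "\<dots> = emeasure ?C {..x}"
      by (simp add: emeasure_density nn_integral_cauchy_density_atMost b_def)
    finally show "cdf ?T x = cdf ?C x"
      by (simp add: cdf_def measure_def)
  qed
qed

lemma char_cauchy:
  assumes "0 \<le> t"
  shows "char (density lborel (\<lambda>z. ennreal (cauchy_density z))) t = of_real (exp (- t))"
proof -
  have [measurable]: "(\<lambda>s. tan (pi * s - pi / 2)) \<in> borel_measurable borel"
    unfolding tan_def by measurable
  \<comment> \<open>Both sides are -cot (pi * s), the ratio for the rotated point z = 1; the circle
    mean then applies with a one-element index set and weight 1.\<close>
  have tan_eq: "tan (pi * s - pi / 2) = Re (cis (- (pi * s)) * 1) / Im (cis (- (pi * s)) * 1)" for s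
    by (simp add: tan_def sin_diff cos_diff)
  have "char (density lborel (\<lambda>z. ennreal (cauchy_density z))) t =
      (LINT s|unit_uniform. iexp (t * tan (pi * s - pi / 2)))"
    unfolding char_def distr_unit_uniform_tan[symmetric] by (rule integral_distr) auto
  also have "\<dots> = of_real (exp (- t))"
    using mean_iexp_rotated_ratios[of "{()}" "\<lambda>_. 1" "\<lambda>_. 1" t] assms
    unfolding tan_eq by simp
  finally show ?thesis .
qed

lemma char_uminus: "char M (- t) = cnj (char M t)"
proof -
  have "cnj (char M t) = (LINT x|M. cnj (iexp (t * x)))"
    unfolding char_def by (rule Bochner_Integration.integral_cnj[symmetric])
  then show ?thesis
    by (simp add: char_def exp_cnj)
qed

text \<open>The circle mean is available only for t \<ge> 0. Conjugate symmetry of characteristic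
  functions supplies negative t, and Levy's theorem then identifies the law.\<close>

lemma eq_cauchy_if_char_eq:
  assumes "real_distribution M" and "\<And>t. 0 \<le> t \<Longrightarrow> char M t = of_real (exp (- t))"
  shows "M = density lborel (\<lambda>z. ennreal (cauchy_density z))" (is "M = ?C")
proof (rule Levy_uniqueness[OF assms(1) real_distribution_cauchy])
  show "char M = char ?C"
  proof
    fix t
    show "char M t = char ?C t"
    proof (cases "0 \<le> t")
      case True
      then show ?thesis
        by (simp only: assms(2) char_cauchy)
    next
      case False
      then have "char M (- t) = char ?C (- t)"
        by (simp only: assms(2) char_cauchy)
      then show ?thesis
        by (simp only: char_uminus complex_cnj_cancel_iff)
    qed
  qed
qed

section \<open>Rotations: invariance of the quadratic forms and of Lebesgue measure\<close>

definition rotation :: "real \<Rightarrow> 'a::real_vector \<times> 'a \<Rightarrow> 'a \<times> 'a" where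
  "rotation \<theta> p =
    (cos \<theta> *\<^sub>R fst p + sin \<theta> *\<^sub>R snd p, cos \<theta> *\<^sub>R snd p - sin \<theta> *\<^sub>R fst p)"

text \<open>With z = x + i y the form is the real part of z^* (A - i B) z, and the rotation
  multiplies z by e^{-i theta}. This unimodular factor cancels against its conjugate; below, the
  cancellation appears as cos^2 + sin^2 = 1.\<close>

lemma block_qf_rotation:
  "block_qf A B (fst (rotation \<theta> (x, y))) (snd (rotation \<theta> (x, y))) = block_qf A B x y"
proof -
  define c s where "c = cos \<theta>" and "s = sin \<theta>"
  have "c\<^sup>2 + s\<^sup>2 = 1"
    by (simp add: c_def s_def)
  then have cs: "c * c = 1 - s * s"
    by (simp add: power2_eq_square)
  have neg: "(- B) *v u = - (B *v u)" for u
    by (simp add: matrix_vector_mult_def vec_eq_iff sum_negf)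
  have "block_qf A B (c *\<^sub>R x + s *\<^sub>R y) (c *\<^sub>R y - s *\<^sub>R x) =
      (c * c + s * s) * (x \<bullet> (A *v x) + y \<bullet> (A *v y) + x \<bullet> (B *v y) - y \<bullet> (B *v x))"
    unfolding block_qf_def neg
    by (simp add: matrix_vector_right_distrib matrix_vector_mult_diff_distrib
        matrix_vector_mult_scaleR inner_add_left inner_add_right inner_diff_left inner_diff_right
        algebra_simps)
  also have "\<dots> = block_qf A B x y"
    unfolding block_qf_def neg by (simp add: cs inner_add_right inner_diff_right)
  finally show ?thesis
    by (simp add: rotation_def c_def s_def)
qed

lemma nn_integral_lborel_translate:
  fixes f :: "'a::euclidean_space \<Rightarrow> ennreal"
  assumes [measurable]: "f \<in> borel_measurable borel"
  shows "(\<integral>\<^sup>+x. f (c + x) \<partial>lborel) = (\<integral>\<^sup>+x. f x \<partial>lborel)"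
proof -
  have "(\<integral>\<^sup>+x. f x \<partial>lborel) = (\<integral>\<^sup>+x. f x \<partial>distr lborel borel ((+) c))"
    by (simp add: lborel_distr_plus)
  also have "\<dots> = (\<integral>\<^sup>+x. f (c + x) \<partial>lborel)"
    by (rule nn_integral_distr) auto
  finally show ?thesis ..
qed

text \<open>For a fixed second component y the map translates the first component by
  \<open>a *\<^sub>R y\<close>, which the inner integral does not notice.\<close>

lemma nn_integral_lborel_shear_fst:
  fixes f :: "'a::euclidean_space \<times> 'a \<Rightarrow> ennreal"
  assumes [measurable]: "f \<in> borel_measurable borel"
  shows "(\<integral>\<^sup>+p. f (fst p + a *\<^sub>R snd p, snd p) \<partial>lborel) = (\<integral>\<^sup>+p. f p \<partial>lborel)"
proof -
  have m: "(\<lambda>p. f (fst p + a *\<^sub>R snd p, snd p)) \<in> borel_measurable borel"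
    by (rule measurable_compose[OF borel_measurable_continuous_onI assms]) (intro continuous_intros)
  have m': "(\<lambda>x. f (x, y)) \<in> borel_measurable borel" for y
    by (rule measurable_compose[OF borel_measurable_continuous_onI assms]) (intro continuous_intros)
  have "(\<integral>\<^sup>+p. f (fst p + a *\<^sub>R snd p, snd p) \<partial>lborel) =
      (\<integral>\<^sup>+y. \<integral>\<^sup>+x. f (x + a *\<^sub>R y, y) \<partial>lborel \<partial>lborel)"
    unfolding lborel_prod[symmetric] using m
    by (subst lborel_pair.nn_integral_snd[symmetric]) (simp_all add: lborel_prod)
  also have "\<dots> = (\<integral>\<^sup>+y. \<integral>\<^sup>+x. f (x, y) \<partial>lborel \<partial>lborel)"
    by (subst add.commute) (simp only: nn_integral_lborel_translate[OF m'])
  also have "\<dots> = (\<integral>\<^sup>+p. f p \<partial>lborel)"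
    unfolding lborel_prod[symmetric] using assms
    by (subst lborel_pair.nn_integral_snd[symmetric]) (simp_all add: lborel_prod)
  finally show ?thesis .
qed

lemma nn_integral_lborel_shear_snd:
  fixes f :: "'a::euclidean_space \<times> 'a \<Rightarrow> ennreal"
  assumes [measurable]: "f \<in> borel_measurable borel"
  shows "(\<integral>\<^sup>+p. f (fst p, snd p + a *\<^sub>R fst p) \<partial>lborel) = (\<integral>\<^sup>+p. f p \<partial>lborel)"
proof -
  have m: "(\<lambda>p. f (fst p, snd p + a *\<^sub>R fst p)) \<in> borel_measurable borel"
    by (rule measurable_compose[OF borel_measurable_continuous_onI assms]) (intro continuous_intros)
  have m': "(\<lambda>y. f (x, y)) \<in> borel_measurable borel" for x
    by (rule measurable_compose[OF borel_measurable_continuous_onI assms]) (intro continuous_intros)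
  have "(\<integral>\<^sup>+p. f (fst p, snd p + a *\<^sub>R fst p) \<partial>lborel) =
      (\<integral>\<^sup>+x. \<integral>\<^sup>+y. f (x, y + a *\<^sub>R x) \<partial>lborel \<partial>lborel)"
    unfolding lborel_prod[symmetric] using m
    by (subst lborel.nn_integral_fst[symmetric]) (simp_all add: lborel_prod)
  also have "\<dots> = (\<integral>\<^sup>+x. \<integral>\<^sup>+y. f (x, y) \<partial>lborel \<partial>lborel)"
    by (subst add.commute) (simp only: nn_integral_lborel_translate[OF m'])
  also have "\<dots> = (\<integral>\<^sup>+p. f p \<partial>lborel)"
    unfolding lborel_prod[symmetric] using assms
    by (subst lborel.nn_integral_fst[symmetric]) (simp_all add: lborel_prod)
  finally show ?thesis .
qed

lemma borel_measurable_rotation: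
  "rotation \<theta> \<in> borel_measurable (borel :: ('a::euclidean_space \<times> 'a) measure)"
  unfolding rotation_def by (intro borel_measurable_continuous_onI continuous_intros)

text \<open>The rotation is a product of three shears, and shears preserve Lebesgue measure by Fubini.\<close>
lemma distr_lborel_rotation:
  assumes "sin \<theta> \<noteq> 0"
  shows "distr lborel lborel (rotation \<theta>) = (lborel :: ('a::euclidean_space \<times> 'a) measure)"
proof (rule measure_eqI)
  fix E assume "E \<in> sets (distr lborel lborel (rotation \<theta>) :: ('a \<times> 'a) measure)"
  then have E: "E \<in> sets borel" by simp
  define f :: "'a \<times> 'a \<Rightarrow> ennreal" where "f = indicator E"
  have f: "f \<in> borel_measurable borel"
    unfolding f_def using E by measurable
  \<comment> \<open>This is tan (theta / 2), the coefficient for which the shears by a, -sin theta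
    and a compose to the rotation. The identities for a * sin theta and a * (1 + cos theta) produce
    its entries cos theta and sin theta.\<close>
  define a where "a = (1 - cos \<theta>) / sin \<theta>"
  define S where "S p = (fst p + a *\<^sub>R snd p, snd p)" for p :: "'a \<times> 'a"
  define L where "L p = (fst p, snd p + (- sin \<theta>) *\<^sub>R fst p)" for p :: "'a \<times> 'a"
  have S: "S \<in> borel_measurable borel" and L: "L \<in> borel_measurable borel"
    unfolding S_def L_def by (intro borel_measurable_continuous_onI continuous_intros)+
  have a: "a * sin \<theta> = 1 - cos \<theta>"
    using assms by (simp add: a_def)
  have "(1 - cos \<theta>) * (1 + cos \<theta>) = sin \<theta> * sin \<theta>"
    using sin_cos_squared_add[of \<theta>] by (simp add: algebra_simps power2_eq_square)
  then have a': "a * (1 + cos \<theta>) = sin \<theta>"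
    using assms by (simp add: a_def field_simps)
  have rot: "rotation \<theta> p = S (L (S p))" for p :: "'a \<times> 'a"
  proof (rule prod_eqI)
    have "fst (S (L (S p))) = (1 - a * sin \<theta>) *\<^sub>R fst p + (a + a * (1 - a * sin \<theta>)) *\<^sub>R snd p"
      by (simp add: S_def L_def algebra_simps flip: scaleR_2)
    also have "a + a * (1 - a * sin \<theta>) = a * (1 + cos \<theta>)"
      unfolding a by (simp add: algebra_simps)
    finally show "fst (rotation \<theta> p) = fst (S (L (S p)))"
      unfolding a a' by (simp add: rotation_def)
    have "snd (S (L (S p))) = (1 - a * sin \<theta>) *\<^sub>R snd p - sin \<theta> *\<^sub>R fst p"
      by (simp add: S_def L_def algebra_simps)
    then show "snd (rotation \<theta> p) = snd (S (L (S p)))"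
      unfolding a by (simp add: rotation_def)
  qed
  have "emeasure (distr lborel lborel (rotation \<theta>)) E = (\<integral>\<^sup>+p. f p \<partial>distr lborel lborel (rotation \<theta>))"
    using E by (simp add: f_def)
  also have "\<dots> = (\<integral>\<^sup>+p. f (S (L (S p))) \<partial>lborel)"
    by (subst nn_integral_distr) (use f borel_measurable_rotation in \<open>simp_all add: rot\<close>)
  \<comment> \<open>The shears are removed one at a time, innermost first, each by applying its
    invariance to the composition that remains outside it.\<close>
  also have "\<dots> = (\<integral>\<^sup>+p. f (S (L p)) \<partial>lborel)"
    using nn_integral_lborel_shear_fst[OF measurable_compose[OF measurable_compose[OF L S] f], of a]
    by (simp only: S_def[symmetric])
  also have "\<dots> = (\<integral>\<^sup>+p. f (S p) \<partial>lborel)"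
    using nn_integral_lborel_shear_snd[OF measurable_compose[OF S f], of "- sin \<theta>"]
    by (simp only: L_def[symmetric])
  also have "\<dots> = (\<integral>\<^sup>+p. f p \<partial>lborel)"
    using nn_integral_lborel_shear_fst[OF f, of a] by (simp only: S_def[symmetric])
  also have "\<dots> = emeasure lborel E"
    using E by (simp add: f_def)
  finally show "emeasure (distr lborel lborel (rotation \<theta>)) E = emeasure lborel E" .
qed simp

section \<open>Weighted ratios under a rotation-invariant law\<close>

lemma borel_measurable_pair_components [measurable]:
  "(\<lambda>p. fst p $ j) \<in> borel_measurable (borel :: ((real^'m) \<times> (real^'m)) measure)"
  "(\<lambda>p. snd p $ j) \<in> borel_measurable (borel :: ((real^'m) \<times> (real^'m)) measure)"
  by (intro borel_measurable_continuous_onI continuous_intros)+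

text \<open>The joint law enters only through rotation invariance and the almost sure nonvanishing
  of each denominator. Averaging the characteristic function over the angle and exchanging the
  integrals leaves, at almost every point, a circle mean equal to e^{-t}.\<close>

lemma weighted_ratios_cauchy_if_rotation_invariant:
  fixes D :: "((real^'m) \<times> (real^'m)) measure" and w :: "real^'m"
  assumes D: "prob_space D" and sets_D [measurable_cong]: "sets D = sets borel"
    and inv: "\<And>\<theta>. 0 < \<theta> \<Longrightarrow> \<theta> < pi \<Longrightarrow> distr D borel (rotation \<theta>) = D"
    and nz: "\<And>j. AE p in D. snd p $ j \<noteq> 0"
    and w: "\<And>j. 0 \<le> w $ j" "(\<Sum>j\<in>UNIV. w $ j) = 1"
  shows "distr D borel (\<lambda>p. \<Sum>j\<in>UNIV. w $ j * (fst p $ j / snd p $ j)) =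
    density lborel (\<lambda>z. ennreal (cauchy_density z))"
proof (rule eq_cauchy_if_char_eq)
  interpret D: prob_space D by (rule D)
  interpret U: prob_space unit_uniform by (rule prob_space_unit_uniform)
  interpret P: pair_prob_space D unit_uniform ..
  define R where "R p = (\<Sum>j\<in>UNIV. w $ j * (fst p $ j / snd p $ j))"
    for p :: "(real^'m) \<times> (real^'m)"
  have R [measurable]: "R \<in> borel_measurable borel"
    unfolding R_def by measurable
  have rot: "rotation \<theta> \<in> measurable D borel" for \<theta>
    using borel_measurable_rotation sets_D by (simp cong: measurable_cong_sets)
  show "real_distribution (distr D borel (\<lambda>p. \<Sum>j\<in>UNIV. w $ j * (fst p $ j / snd p $ j)))"
    by (rule D.real_distribution_distr) (fold R_def, measurable)
  fix t :: real assume t: "0 \<le> t"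
  define H where "H p s = iexp (t * R (rotation (pi * s) p))" for p s
  have H_meas [measurable]: "(\<lambda>(p, s). H p s) \<in> borel_measurable (D \<Otimes>\<^sub>M unit_uniform)"
    unfolding H_def R_def rotation_def by simp
  have "char (distr D borel R) t = (LINT p|D. iexp (t * R p))"
    unfolding char_def by (rule integral_distr) auto
  \<comment> \<open>A constant is averaged over s; invariance then allows p to be rotated by pi * s
    inside the average.\<close>
  also have "\<dots> = (LINT s|unit_uniform. (LINT p|D. iexp (t * R p)))"
    using U.prob_space by simp
  also have "\<dots> = (LINT s|unit_uniform. (LINT p|D. H p s))"
  proof (rule integral_cong_AE)
    have "(LINT p|D. iexp (t * R p)) = (LINT p|D. H p s)" if "s \<in> {0<..<1}" for s
    proof -
      have "distr D borel (rotation (pi * s)) = D"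
        using that by (intro inv) auto
      then have "(LINT p|D. iexp (t * R p)) = (LINT p|distr D borel (rotation (pi * s)). iexp (t * R p))"
        by simp
      also have "\<dots> = (LINT p|D. H p s)"
        unfolding H_def by (rule integral_distr[OF rot]) auto
      finally show ?thesis .
    qed
    then show "AE s in unit_uniform. (LINT p|D. iexp (t * R p)) = (LINT p|D. H p s)"
      by (rule eventually_mono[OF AE_unit_uniform_in])
  qed auto
  also have "\<dots> = (LINT p|D. (LINT s|unit_uniform. H p s))"
  proof (rule P.Fubini_integral)
    show "integrable (D \<Otimes>\<^sub>M unit_uniform) (case_prod H)"
      by (rule P.integrable_const_bound[where B = 1]) (auto simp: H_def)
  qed
  also have "\<dots> = (LINT p|D. of_real (exp (- t)))"
  proof (rule integral_cong_AE)
    have "AE p in D. \<forall>j. snd p $ j \<noteq> 0"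
      using nz by (simp add: AE_all_countable)
    then show "AE p in D. (LINT s|unit_uniform. H p s) = of_real (exp (- t))"
    proof eventually_elim
      case (elim p)
      \<comment> \<open>In each coordinate the rotation by pi * s is multiplication of x_j + i y_j
        by e^{-i pi s}. The condition y_j \<noteq> 0 ensures that this complex number is
        nonzero.\<close>
      have "H p s = iexp (t * (\<Sum>j\<in>UNIV. w $ j *
        (Re (cis (- (pi * s)) * Complex (fst p $ j) (snd p $ j)) /
         Im (cis (- (pi * s)) * Complex (fst p $ j) (snd p $ j)))))" for s
        by (simp add: H_def R_def rotation_def)
      then show ?case
        using elim w t
        by (simp only:) (rule mean_iexp_rotated_ratios, auto simp: complex_eq_iff)
    qed
  qed auto
  also have "\<dots> = of_real (exp (- t))"
    using D.prob_space by simp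
  finally show "char (distr D borel (\<lambda>p. \<Sum>j\<in>UNIV. w $ j * (fst p $ j / snd p $ j))) t = of_real (exp (- t))"
    by (simp only: R_def[abs_def])
qed

section \<open>From the joint density to the law of the ratios\<close>

lemma distr_density_lborel_rotation:
  fixes d :: "'a::euclidean_space \<times> 'a \<Rightarrow> ennreal"
  assumes d: "d \<in> borel_measurable borel" and inv: "\<And>p. d (rotation \<theta> p) = d p"
    and \<theta>: "sin \<theta> \<noteq> 0"
  shows "distr (density lborel d) borel (rotation \<theta>) = density lborel d"
proof -
  \<comment> \<open>Lebesgue measure is replaced by its rotated image, so that the density can be
    pulled back along the rotation, where it is unchanged.\<close>
  have "density lborel d = density (distr lborel lborel (rotation \<theta>)) d"
    by (simp add: distr_lborel_rotation[OF \<theta>])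
  also have "\<dots> = distr (density lborel (\<lambda>p. d (rotation \<theta> p))) lborel (rotation \<theta>)"
    by (rule density_distr) (use d borel_measurable_rotation in simp_all)
  also have "\<dots> = distr (density lborel d) borel (rotation \<theta>)"
    by (simp add: inv cong: distr_cong)
  finally show ?thesis ..
qed

lemma AE_lborel_snd_component_neq_0:
  "AE p in (lborel :: ((real^'m) \<times> (real^'m)) measure). snd p $ j \<noteq> 0"
proof -
  have "negligible {p :: (real^'m) \<times> (real^'m). (0, axis j 1) \<bullet> p = 0}"
    by (rule negligible_hyperplane) (simp add: zero_prod_def axis_eq_0_iff)
  moreover have "{p :: (real^'m) \<times> (real^'m). (0, axis j 1) \<bullet> p = 0} = {p. snd p $ j = 0}"
    by (auto simp: inner_prod_def inner_axis')
  \<comment> \<open>A negligible set is null for the completed measure; closedness makes the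
    hyperplane Borel, hence null for \<open>lborel\<close> itself.\<close>
  moreover have "closed {p :: (real^'m) \<times> (real^'m). snd p $ j = 0}"
    by (intro closed_Collect_eq continuous_intros)
  ultimately have "{p :: (real^'m) \<times> (real^'m). snd p $ j = 0} \<in> null_sets lborel"
    by (simp add: negligible_iff_null_sets null_sets_completion_iff)
  from AE_not_in[OF this] show ?thesis by simp
qed

theorem theorem3p1:
  fixes M :: "'a measure"
    and X Y :: "'a \<Rightarrow> real^'m"
    and n :: nat
    and h :: "nat \<Rightarrow> real \<Rightarrow> real"
    and A B :: "nat \<Rightarrow> real^'m^'m"
    and w :: "real^'m"
  assumes "prob_space M"
    and "CARD('m) > 1"
    and "n \<ge> 1"
    and "\<forall>i\<in>{1..n}. h i \<in> borel_measurable borel \<and> (\<forall>t. h i t \<ge> 0)"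
    and "\<forall>i\<in>{1..n}. transpose (A i) = A i \<and> transpose (B i) = - B i"
    and "integrable lborel (\<lambda>(x, y). \<Prod>i\<in>{1..n}. h i (block_qf (A i) (B i) x y))"
    and "(LINT z|lborel. (\<lambda>(x, y). \<Prod>i\<in>{1..n}. h i (block_qf (A i) (B i) x y)) z) > 0"
    and "distributed M lborel (\<lambda>\<omega>. (X \<omega>, Y \<omega>))
           (\<lambda>(x, y). ennreal ((\<Prod>i\<in>{1..n}. h i (block_qf (A i) (B i) x y)) /
              (LINT z|lborel. (\<lambda>(x, y). \<Prod>i\<in>{1..n}. h i (block_qf (A i) (B i) x y)) z)))"
    and "\<forall>j. w $ j \<ge> 0"
    and "(\<Sum>j\<in>UNIV. w $ j) = 1"
  shows "distributed M lborel (\<lambda>\<omega>. \<Sum>j\<in>UNIV. w $ j * (X \<omega> $ j / Y \<omega> $ j))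
           (\<lambda>z. ennreal (cauchy_density z))
         \<and> (\<forall>j. distributed M lborel (\<lambda>\<omega>. X \<omega> $ j / Y \<omega> $ j)
           (\<lambda>z. ennreal (cauchy_density z)))"
proof -
  interpret M: prob_space M by (rule assms(1))
  define I where "I = (LINT z|lborel. (\<lambda>(x, y). \<Prod>i\<in>{1..n}. h i (block_qf (A i) (B i) x y)) z)"
  define d :: "(real^'m) \<times> (real^'m) \<Rightarrow> ennreal" where
    "d = (\<lambda>(x, y). ennreal ((\<Prod>i\<in>{1..n}. h i (block_qf (A i) (B i) x y)) / I))"
  define D where "D = distr M borel (\<lambda>\<omega>. (X \<omega>, Y \<omega>))"
  have dist: "distributed M lborel (\<lambda>\<omega>. (X \<omega>, Y \<omega>)) d"
    using assms(8) unfolding d_def I_def .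
  have d [measurable]: "d \<in> borel_measurable borel"
    using distributed_borel_measurable[OF dist] by simp
  have XY: "(\<lambda>\<omega>. (X \<omega>, Y \<omega>)) \<in> measurable M borel"
    using distributed_measurable[OF dist] by simp
  have D_eq: "D = density lborel d"
    using distributed_distr_eq_density[OF dist] unfolding D_def by (simp cong: distr_cong)
  \<comment> \<open>The density depends on the point only through the quadratic forms, each of which
    is invariant.\<close>
  have d_rot: "d (rotation \<theta> p) = d p" for \<theta> p
    using block_qf_rotation[of _ _ \<theta> "fst p" "snd p"] by (simp add: d_def case_prod_beta)
  have "sin \<theta> \<noteq> 0" if "0 < \<theta>" "\<theta> < pi" for \<theta>
    using sin_gt_zero[OF that] by simp
  then have D_rot: "distr D borel (rotation \<theta>) = D" if "0 < \<theta>" "\<theta> < pi" for \<theta>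
    unfolding D_eq using that by (intro distr_density_lborel_rotation d d_rot)
  have D_nz: "AE p in D. snd p $ j \<noteq> 0" for j
    unfolding D_eq using AE_lborel_snd_component_neq_0[of j]
    by (subst AE_density) (auto elim!: eventually_mono)
  have D_prob: "prob_space D"
    unfolding D_def by (rule M.prob_space_distr[OF XY])
  have sets_D: "sets D = sets borel"
    by (simp add: D_def)
  \<comment> \<open>Arbitrary weights \<open>u\<close> cover both claims: \<open>w\<close> gives the
    weighted sum, and the unit vector \<open>axis j 1\<close> gives the single ratio.\<close>
  have main: "distributed M lborel (\<lambda>\<omega>. \<Sum>j\<in>UNIV. u $ j * (X \<omega> $ j / Y \<omega> $ j))
      (\<lambda>z. ennreal (cauchy_density z))"
    if u: "\<And>j. 0 \<le> u $ j" "(\<Sum>j\<in>UNIV. u $ j) = 1" for u :: "real^'m"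
  proof -
    define R where "R p = (\<Sum>j\<in>UNIV. u $ j * (fst p $ j / snd p $ j))"
      for p :: "(real^'m) \<times> (real^'m)"
    have R: "R \<in> borel_measurable borel"
      unfolding R_def by measurable
    have "distr M lborel (R \<circ> (\<lambda>\<omega>. (X \<omega>, Y \<omega>))) = distr D borel R"
      unfolding D_def distr_distr[OF R XY] by (simp cong: distr_cong)
    also have "\<dots> = density lborel (\<lambda>z. ennreal (cauchy_density z))"
      unfolding R_def[abs_def]
      by (rule weighted_ratios_cauchy_if_rotation_invariant[OF D_prob sets_D D_rot D_nz u])
    finally have "distributed M lborel (R \<circ> (\<lambda>\<omega>. (X \<omega>, Y \<omega>))) (\<lambda>z. ennreal (cauchy_density z))"
      unfolding distributed_def using measurable_comp[OF XY R] by simp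
    then show ?thesis
      by (simp add: R_def comp_def)
  qed
  moreover have "distributed M lborel (\<lambda>\<omega>. X \<omega> $ j / Y \<omega> $ j)
      (\<lambda>z. ennreal (cauchy_density z))" for j
    using main[of "axis j 1"] by (simp add: axis_def if_distrib if_distribR cong: if_cong)
  ultimately show ?thesis
    using assms(9,10) by blast
qed

end
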